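(* Let $k$ be a field of characteristic two, and let $f\in k[X]$ be a monic polynomial of degree $n\geq 1$. Then $f$ is the characteristic polynomial of a symmetric matrix of $\mathrm{M}_n(k)$ if and only if it is not the product of pairwise distinct monic irreducible inseparable polynomials of $k[X]$. In particular, if $k$ is perfect, any monic polynomial $f\in k[X]$ of degree $n\geq 1$ is the characteristic polynomial of a symmetric matrix of $\mathrm{M}_n(k)$.
   Context: $\mathrm{M}_n(k)$ denotes the ring of $n\times n$ matrices with entries in $k$. An irreducible polynomial of $k[X]$ is separable if it has no multiple root in an algebraic closure of $k$, and inseparable otherwise. A product of pairwise distinct polynomials may consist of a single factor. *)

theory Defs
  imports
    "HOL-Algebra.Algebraic_Closure_Type"
    "Jordan_Normal_Form.Char_Poly"
begin

text \<open>
  A multiple root is one of order at least 2; the type \<^typ>\<open>'a alg_closure\<close> is an algebraic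
  closure of \<^typ>\<open>'a\<close>, with embedding \<^const>\<open>to_ac\<close>. Since \<^term>\<open>Polynomial.order x 0\<close> is
  unspecified, the notion is meaningful for nonzero polynomials only.
\<close>

definition separable_poly :: "'a :: field poly \<Rightarrow> bool" where
  "separable_poly p \<longleftrightarrow>
     \<not> (\<exists>x :: 'a alg_closure. Polynomial.order x (map_poly to_ac p) \<ge> 2)"

definition inseparable_poly :: "'a :: field poly \<Rightarrow> bool" where
  "inseparable_poly p \<longleftrightarrow> \<not> separable_poly p"

definition perfect_field :: "'a :: field itself \<Rightarrow> bool" where
  "perfect_field _ \<longleftrightarrow> CHAR('a) = 0 \<or> surj (\<lambda>x :: 'a. x ^ CHAR('a))"

definition symmetric_mat :: "'a mat \<Rightarrow> bool" where
  "symmetric_mat A \<longleftrightarrow> transpose_mat A = A"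

end

theory Submission
  imports Defs
begin

text \<open>
  Necessity. Let \<open>A\<close> be symmetric with characteristic polynomial \<open>f\<close>, let \<open>N\<close> be the adjugate of
  \<open>X - A\<close>, and suppose that \<open>f\<close> is a product of inseparable polynomials, so that \<open>f' = 0\<close>.
  Differentiating \<open>(X - A) N = f\<close> and multiplying by \<open>N\<close> gives \<open>N\<^sup>2 = - f N'\<close>. Since \<open>N\<close> is symmetric,
  the diagonal entries of \<open>N\<^sup>2\<close> are, in characteristic two, the squares of the column sums of \<open>N\<close>,
  which are therefore divisible by \<open>f\<close>. If the factors were distinct, \<open>f\<close> would divide the column
  sums themselves; having degree less than \<open>n\<close>, they would vanish, although \<open>N\<close> is invertible over
  the field of fractions.

  Sufficiency. Write \<open>\<tau> g\<close> for the coefficient of degree \<open>n - 1\<close> of \<open>g mod f\<close>. If \<open>r\<close> is prime to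
  \<open>f\<close>, the form \<open>(g, h) \<mapsto> \<tau> (r g h)\<close> on \<open>k[X]/(f)\<close> is nondegenerate and multiplication by \<open>X\<close> is
  self-adjoint for it; in an orthonormal basis, the latter becomes a symmetric matrix with
  characteristic polynomial \<open>f\<close>. In characteristic two such a basis exists once the form is not
  alternating and all values \<open>\<tau> (r g\<^sup>2)\<close> are squares. If \<open>(r f)' = s\<^sup>2\<close>, then
  \<open>\<tau> (r g\<^sup>2) = (\<tau> (s g))\<^sup>2\<close>, and the form is not alternating if \<open>f\<close> does not divide \<open>s\<close>. Partial
  fractions reduce the construction of \<open>r\<close> and \<open>s\<close> to prime powers, where it is explicit; \<open>f\<close> divides
  \<open>s\<close> only if all prime factors are simple and inseparable.
\<close>

section \<open>Separability and derivatives\<close>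

lemma order_ge_2_iff:
  fixes p :: "'a :: idom poly"
  assumes "p \<noteq> 0"
  shows "Polynomial.order x p \<ge> 2 \<longleftrightarrow> poly p x = 0 \<and> poly (pderiv p) x = 0"
proof (cases "poly p x = 0")
  case True
  then obtain q where p_eq: "p = [:- x, 1:] * q"
    by (auto simp: poly_eq_0_iff_dvd)
  have "Polynomial.order x p \<ge> 2 \<longleftrightarrow> [:- x, 1:] * [:- x, 1:] dvd p"
    using assms by (simp only: order_divides simp_thms flip: power2_eq_square)
  also have "\<dots> \<longleftrightarrow> poly q x = 0"
    unfolding p_eq poly_eq_0_iff_dvd by (subst dvd_mult_cancel_left) simp
  also have "poly q x = poly (pderiv p) x"
    unfolding p_eq pderiv_mult by (simp add: pderiv_pCons)
  finally show ?thesis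
    using True by simp
next
  case False
  then show ?thesis
    by (simp add: order_0I)
qed

context field_hom
begin

lemma poly_map_poly_mod_eq_0:
  assumes "poly (map_poly hom p) x = 0" "poly (map_poly hom g) x = 0"
  shows "poly (map_poly hom (p mod g)) x = 0"
proof -
  interpret poly_hom: map_poly_comm_ring_hom hom ..
  have "map_poly hom (p mod g) = map_poly hom p - map_poly hom (p div g) * map_poly hom g"
    by (metis poly_hom.hom_mult poly_hom.hom_minus minus_div_mult_eq_mod)
  with assms show ?thesis
    by simp
qed

lemma not_unit_if_root:
  assumes "g \<noteq> 0" "poly (map_poly hom g) x = 0"
  shows "\<not> g dvd 1"
proof
  assume "g dvd 1"
  then obtain a where "g = [:a:]"
    by (metis degree_eq_zeroE is_unit_field_poly)
  then show False
    using assms by (simp add: map_poly_pCons)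
qed

lemma irreducible_dvd_if_common_root:
  assumes p: "irreducible p" "poly (map_poly hom p) x = 0"
    and g: "poly (map_poly hom g) x = 0"
  shows "p dvd g"
  using g
proof (induction "degree g" arbitrary: g rule: less_induct)
  case less
  have "p \<noteq> 0"
    using p(1) by auto
  consider (zero) "g = 0" | (ge) "g \<noteq> 0" "degree p \<le> degree g"
    | (lt) "g \<noteq> 0" "degree g < degree p"
    by linarith
  then show ?case
  proof cases
    case ge
    then have "p dvd g mod p"
      using less.hyps[of "g mod p"] poly_map_poly_mod_eq_0[OF less.prems p(2)]
        degree_mod_less'[OF \<open>p \<noteq> 0\<close>, of g] by fastforce
    then show ?thesis
      by (simp add: dvd_mod_iff)
  next
    case lt
    have "p mod g = 0"
    proof (rule ccontr)
      assume "p mod g \<noteq> 0"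
      moreover from this have "degree (p mod g) < degree g"
        using degree_mod_less'[OF \<open>g \<noteq> 0\<close>] by blast
      moreover from this have "p dvd p mod g"
        using less.hyps poly_map_poly_mod_eq_0[OF p(2) less.prems] by blast
      ultimately show False
        using dvd_imp_degree_le[of p "p mod g"] \<open>degree g < degree p\<close> by linarith
    qed
    moreover have "\<not> g dvd 1"
      using not_unit_if_root \<open>g \<noteq> 0\<close> less.prems by blast
    ultimately show ?thesis
      using irreducibleD'[OF p(1)] by (metis mod_eq_0_iff_dvd)
  qed simp
qed

end

lemma not_dvd_pderiv_if_nonzero:
  fixes p :: "'a :: idom poly"
  assumes "pderiv p \<noteq> 0"
  shows "\<not> p dvd pderiv p"
proof
  assume "p dvd pderiv p"
  then have "degree p \<le> degree (pderiv p)"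
    using assms by (rule dvd_imp_degree_le)
  then have "degree p = 0"
    using degree_pderiv_le[of p] by linarith
  then show False
    using assms by (metis degree_eq_zeroE pderiv_singleton)
qed

lemma inseparable_poly_iff_pderiv_eq_0:
  fixes p :: "'a :: field poly"
  assumes p: "irreducible p"
  shows "inseparable_poly p \<longleftrightarrow> pderiv p = 0"
proof -
  interpret to_ac: field_hom "to_ac :: 'a \<Rightarrow> 'a alg_closure"
    by unfold_locales auto
  let ?p = "map_poly to_ac p :: 'a alg_closure poly"
  have "?p \<noteq> 0"
    using p by auto
  then have inseparable_iff: "inseparable_poly p \<longleftrightarrow>
      (\<exists>x. poly ?p x = 0 \<and> poly (map_poly to_ac (pderiv p)) x = 0)"
    by (simp add: inseparable_poly_def separable_poly_def order_ge_2_iff to_ac.map_poly_pderiv)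
  show ?thesis
  proof
    assume "inseparable_poly p"
    then show "pderiv p = 0"
      using inseparable_iff to_ac.irreducible_dvd_if_common_root[OF p] not_dvd_pderiv_if_nonzero
      by blast
  next
    assume "pderiv p = 0"
    moreover have "degree ?p > 0"
      using p by auto
    then obtain x where "poly ?p x = 0"
      using alg_closed_imp_poly_has_root by blast
    ultimately show "inseparable_poly p"
      using inseparable_iff by auto
  qed
qed

lemma coeff_eq_0_if_pderiv_eq_0:
  fixes p :: "'a :: idom poly"
  assumes "pderiv p = 0" "\<not> CHAR('a) dvd k"
  shows "coeff p k = 0"
proof -
  obtain i where "k = Suc i"
    using assms(2) by (cases k) auto
  moreover have "of_nat (Suc i) * coeff p (Suc i) = 0"
    using assms(1) by (metis coeff_0 coeff_pderiv)
  ultimately show ?thesis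
    using assms(2) by (metis mult_eq_0_iff of_nat_eq_0_iff_char_dvd)
qed

lemma ex_power_CHAR_if_pderiv_eq_0:
  fixes p :: "'a :: field poly"
  assumes prime: "prime CHAR('a)" and surj: "surj (\<lambda>x :: 'a. x ^ CHAR('a))" and p: "pderiv p = 0"
  shows "\<exists>g. p = g ^ CHAR('a)"
proof -
  let ?q = "CHAR('a)" and ?d = "degree p"
  have "?q > 0"
    using prime by (rule prime_gt_0_nat)
  obtain root :: "'a \<Rightarrow> 'a" where root: "\<And>a. root a ^ ?q = a"
    using surj by (metis surjD)
  have "p = (\<Sum>k\<le>?d * ?q. monom (coeff p k) k)"
    using \<open>?q > 0\<close> by (intro poly_as_sum_of_monoms'[symmetric]) simp
  also have "\<dots> = (\<Sum>k\<in>(\<lambda>i. i * ?q) ` {..?d}. monom (coeff p k) k)"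
  proof (rule sum.mono_neutral_right)
    show "\<forall>k\<in>{..?d * ?q} - (\<lambda>i. i * ?q) ` {..?d}. monom (coeff p k) k = 0"
    proof
      fix k
      assume k: "k \<in> {..?d * ?q} - (\<lambda>i. i * ?q) ` {..?d}"
      have "\<not> ?q dvd k"
      proof
        assume "?q dvd k"
        then obtain i where "k = i * ?q"
          by (metis dvdE mult.commute)
        then show False
          using k \<open>?q > 0\<close> by auto
      qed
      then show "monom (coeff p k) k = 0"
        using coeff_eq_0_if_pderiv_eq_0[OF p] by simp
    qed
  qed auto
  also have "\<dots> = (\<Sum>i\<le>?d. monom (coeff p (i * ?q)) (i * ?q))"
    using \<open>?q > 0\<close> by (subst sum.reindex) (auto intro: inj_onI)
  also have "\<dots> = (\<Sum>i\<le>?d. monom (root (coeff p (i * ?q))) i) ^ ?q"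
    using prime by (simp add: freshmans_dream_sum[where n = ?q] monom_power root)
  finally show ?thesis ..
qed

lemma separable_poly_if_perfect_field:
  fixes p :: "'a :: field poly"
  assumes perfect: "perfect_field TYPE('a)" and p: "irreducible p"
  shows "separable_poly p"
proof (rule ccontr)
  assume "\<not> separable_poly p"
  then have deriv: "pderiv p = 0"
    using inseparable_poly_iff_pderiv_eq_0[OF p] by (simp add: inseparable_poly_def)
  show False
  proof (cases "CHAR('a) = 0")
    case True
    then have "coeff p k = 0" if "k \<noteq> 0" for k
      using coeff_eq_0_if_pderiv_eq_0[OF deriv, of k] that by simp
    then have "degree p = 0"
      by (metis degree_0 leading_coeff_0_iff)
    then show False
      using p by auto
  next
    case False
    then have prime: "prime CHAR('a)"
      using prime_CHAR_semidom by blast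
    moreover have "surj (\<lambda>x :: 'a. x ^ CHAR('a))"
      using perfect False by (simp add: perfect_field_def)
    ultimately obtain g where "p = g ^ CHAR('a)"
      using ex_power_CHAR_if_pderiv_eq_0 deriv by blast
    then show False
      using p prime_gt_1_nat[OF prime] by (simp add: irreducible_power_iff)
  qed
qed

section \<open>The adjugate of the characteristic matrix\<close>

lemma adj_mat_transpose:
  assumes A: "A \<in> carrier_mat n n"
  shows "adj_mat (transpose_mat A) = transpose_mat (adj_mat A)"
proof (rule eq_matI)
  fix i j
  assume "i < dim_row (transpose_mat (adj_mat A))" "j < dim_col (transpose_mat (adj_mat A))"
  then have ij: "i < n" "j < n"
    using A by (auto simp: adj_mat_def)
  have "mat_delete (transpose_mat A) j i = transpose_mat (mat_delete A i j)"
    using A by (intro eq_matI) (auto simp: mat_delete_def)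
  then have "cofactor (transpose_mat A) j i = cofactor A i j"
    using det_transpose[OF mat_delete_carrier[OF A]] by (simp add: cofactor_def add.commute)
  then show "adj_mat (transpose_mat A) $$ (i, j) = transpose_mat (adj_mat A) $$ (i, j)"
    using A ij by (simp add: adj_mat_def)
qed (use A in \<open>auto simp: adj_mat_def\<close>)

lemma dvd_det_mult:
  fixes M :: "'a :: comm_ring_1 mat"
  assumes M: "M \<in> carrier_mat n n" and k: "k < n"
    and dvd: "\<And>j. j < n \<Longrightarrow> d dvd (\<Sum>i<n. x i * M $$ (i, j))"
  shows "d dvd det M * x k"
proof -
  let ?N = "adj_mat M"
  note N = adj_mat[OF M]
  have "det M * x k = (\<Sum>i<n. x i * (M * ?N) $$ (i, k))"
    using k by (simp add: N(2) if_distrib[of "(*) _"] mult.commute cong: if_cong)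
  also have "\<dots> = (\<Sum>i<n. \<Sum>j<n. x i * M $$ (i, j) * ?N $$ (j, k))"
    using M N(1) k
    by (intro sum.cong refl)
      (simp add: scalar_prod_def sum_distrib_left mult.assoc lessThan_atLeast0)
  also have "\<dots> = (\<Sum>j<n. (\<Sum>i<n. x i * M $$ (i, j)) * ?N $$ (j, k))"
    by (subst sum.swap) (simp add: sum_distrib_right)
  finally show ?thesis
    using dvd by (auto intro: dvd_sum)
qed

lemma map_mat_pderiv_mult:
  fixes A B :: "'a :: idom poly mat"
  assumes "A \<in> carrier_mat n m" "B \<in> carrier_mat m l"
  shows "map_mat pderiv (A * B) = map_mat pderiv A * B + A * map_mat pderiv B"
  using assms
  by (intro eq_matI)
    (auto simp: scalar_prod_def pderiv_sum pderiv_mult sum.distrib mult.commute add.commute)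

context
  fixes A :: "'a :: idom mat" and n :: nat
  assumes A: "A \<in> carrier_mat n n"
begin

private abbreviation "M \<equiv> char_poly_matrix A"

private abbreviation "N \<equiv> adj_mat (char_poly_matrix A)"

private lemma char_poly_matrix_carrier [simp]: "M \<in> carrier_mat n n"
  using A by simp

private lemma adj_char_poly_matrix_carrier [simp]: "N \<in> carrier_mat n n"
  by (rule adj_mat) simp

private lemma char_poly_matrix_dims [simp]:
  "dim_row M = n" "dim_col M = n" "dim_row N = n" "dim_col N = n"
  using char_poly_matrix_carrier adj_char_poly_matrix_carrier by (metis carrier_matD)+

lemma char_poly_matrix_index:
  assumes "i < n" "j < n"
  shows "M $$ (i, j) = (if i = j then [:0, 1:] else 0) - [:A $$ (i, j):]"
  using assms A by (auto simp: char_poly_matrix_def)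

lemma degree_adj_char_poly_matrix_le:
  assumes "i < n" "j < n"
  shows "degree (N $$ (i, j)) \<le> n - 1"
proof -
  have "degree (M $$ (k, l)) \<le> 1" if "k < n" "l < n" for k l
    using that by (auto simp: char_poly_matrix_index)
  then have "degree (det (mat_delete M j i)) \<le> 1 * (n - 1)"
    by (intro degree_det_le) (auto simp: mat_delete_def)
  then show ?thesis
    using assms by (simp add: adj_mat_def cofactor_def minus_one_power_iff)
qed

lemma pderiv_adj_char_poly_matrix:
  "N * N + char_poly A \<cdot>\<^sub>m map_mat pderiv N = pderiv (char_poly A) \<cdot>\<^sub>m N"
proof -
  let ?f = "char_poly A"
  have "map_mat pderiv M = 1\<^sub>m n"
    by (intro eq_matI) (simp_all add: char_poly_matrix_index pderiv_diff pderiv_pCons)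
  moreover have "map_mat pderiv (M * N) = pderiv ?f \<cdot>\<^sub>m 1\<^sub>m n"
    by (subst adj_mat(2)[of _ n]) (auto simp: char_poly_def)
  ultimately have deriv: "pderiv ?f \<cdot>\<^sub>m 1\<^sub>m n = N + M * map_mat pderiv N"
    using map_mat_pderiv_mult[of M n n N n] by simp
  have "pderiv ?f \<cdot>\<^sub>m N = N * (pderiv ?f \<cdot>\<^sub>m 1\<^sub>m n)"
    by (simp add: mult_smult_distrib[of _ n n _ n])
  also have "\<dots> = N * N + N * (M * map_mat pderiv N)"
    unfolding deriv by (rule mult_add_distrib_mat[of _ n n _ n]) auto
  also have "N * (M * map_mat pderiv N) = N * M * map_mat pderiv N"
    by (rule assoc_mult_mat[symmetric, of _ n n _ n _ n]) auto
  also have "\<dots> = ?f \<cdot>\<^sub>m map_mat pderiv N"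
    by (subst adj_mat(3)[of _ n]) (auto simp: char_poly_def mult_smult_assoc_mat[of _ n n _ n])
  finally show ?thesis
    by (rule sym)
qed

lemma adj_char_poly_matrix_symmetric:
  assumes "symmetric_mat A" "i < n" "j < n"
  shows "N $$ (i, j) = N $$ (j, i)"
proof -
  have "A $$ (i, j) = A $$ (j, i)" if "i < n" "j < n" for i j
    using assms(1) A that by (metis carrier_matD index_transpose_mat(1) symmetric_mat_def)
  then have "transpose_mat M = M"
    by (intro eq_matI) (auto simp: char_poly_matrix_index)
  then have "transpose_mat N = N"
    using adj_mat_transpose[of M n] by simp
  then show ?thesis
    using assms(2,3) by (metis adj_char_poly_matrix_carrier carrier_matD index_transpose_mat(1))
qed

lemma char_poly_dvd_power2_sum_adj:
  assumes char: "CHAR('a) = 2" and sym: "symmetric_mat A"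
    and deriv: "pderiv (char_poly A) = 0" and j: "j < n"
  shows "char_poly A dvd (\<Sum>i<n. N $$ (i, j))\<^sup>2"
proof -
  have "(\<Sum>i<n. N $$ (i, j))\<^sup>2 = (\<Sum>i<n. (N $$ (i, j))\<^sup>2)"
    using char by (intro freshmans_dream_sum) simp_all
  also have "\<dots> = (N * N) $$ (j, j)"
    using j adj_char_poly_matrix_symmetric[OF sym _ j]
    by (simp add: scalar_prod_def power2_eq_square lessThan_atLeast0)
  also have "\<dots> = - (char_poly A * pderiv (N $$ (j, j)))"
    using arg_cong[OF pderiv_adj_char_poly_matrix, of "\<lambda>B. B $$ (j, j)"] j deriv
    by (simp add: eq_neg_iff_add_eq_0)
  finally show ?thesis
    by simp
qed

lemma ex_char_poly_not_dvd_sum_adj: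
  assumes "n \<ge> 1"
  shows "\<exists>j<n. \<not> char_poly A dvd (\<Sum>i<n. N $$ (i, j))"
proof (rule ccontr)
  let ?w = "\<lambda>j. \<Sum>i<n. N $$ (i, j)"
  assume "\<not> ?thesis"
  then have dvd: "char_poly A dvd ?w j" if "j < n" for j
    using that by blast
  have "?w j = 0" if "j < n" for j
  proof (rule ccontr)
    assume "?w j \<noteq> 0"
    then have "n \<le> degree (?w j)"
      using dvd_imp_degree_le[OF dvd[OF that]] degree_monic_char_poly[OF A] by simp
    moreover have "degree (?w j) \<le> n - 1"
      using that by (intro degree_sum_le degree_adj_char_poly_matrix_le) auto
    ultimately show False
      using assms by linarith
  qed
  then have "0 = (\<Sum>k<n. ?w k * M $$ (k, 0))"
    by simp
  also have "\<dots> = (\<Sum>i<n. \<Sum>k<n. N $$ (i, k) * M $$ (k, 0))"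
    unfolding sum_distrib_right by (rule sum.swap)
  also have "\<dots> = (\<Sum>i<n. (N * M) $$ (i, 0))"
    using assms by (simp add: scalar_prod_def lessThan_atLeast0)
  also have "\<dots> = char_poly A"
    using assms by (simp add: adj_mat(3)[OF char_poly_matrix_carrier] char_poly_def
        if_distrib[of "(*) _"] cong: if_cong)
  finally show False
    using degree_monic_char_poly[OF A] by auto
qed

end

lemma symmetric_char_poly_dvd_power2_not_dvd:
  fixes A :: "'a :: idom mat"
  assumes "A \<in> carrier_mat n n" "n \<ge> 1" "symmetric_mat A"
    and "CHAR('a) = 2" "pderiv (char_poly A) = 0"
  obtains g where "char_poly A dvd g\<^sup>2" "\<not> char_poly A dvd g"
  using assms char_poly_dvd_power2_sum_adj ex_char_poly_not_dvd_sum_adj by metis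

section \<open>Monic irreducible factors\<close>

lemma monic_dvd_eq:
  fixes p q :: "'a :: idom poly"
  assumes "monic p" "monic q" "p dvd q" "degree q \<le> degree p"
  shows "p = q"
proof -
  obtain c where q_eq: "q = p * c"
    using assms(3) ..
  have "p \<noteq> 0" "q \<noteq> 0"
    using assms(1,2) by auto
  then have "degree c = 0"
    using assms(4) by (simp add: q_eq degree_mult_eq)
  moreover have "lead_coeff c = 1"
    using assms(1,2) by (metis q_eq lead_coeff_mult mult_1)
  ultimately have "c = 1"
    by (metis degree_eq_zeroE lead_coeff_pCons(2) one_pCons)
  then show ?thesis
    by (simp add: q_eq)
qed

lemma monic_irreducible_dvd_eq:
  fixes p q :: "'a :: field poly"
  assumes "monic p" "irreducible p" "monic q" "irreducible q" "p dvd q"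
  shows "p = q"
proof -
  obtain c where q_eq: "q = p * c"
    using assms(5) ..
  then have "c dvd 1"
    using irreducibleD[OF assms(4)] irreducible_not_unit[OF assms(2)] by blast
  then have "q dvd p"
    by (simp only: q_eq mult_unit_dvd_iff dvd_refl)
  then have "degree q \<le> degree p"
    using assms(1) by (intro dvd_imp_degree_le) auto
  then show ?thesis
    using monic_dvd_eq assms by metis
qed

lemma prime_elem_dvd_prodE:
  fixes p :: "'a :: algebraic_semidom"
  assumes "prime_elem p" "p dvd (\<Prod>i\<in>I. f i)"
  obtains i where "i \<in> I" "p dvd f i"
  using assms
  by (induction I rule: infinite_finite_induct) (auto simp: prime_elem_dvd_mult_iff)

lemma monic_irreducible_not_dvd_prod_powers:
  fixes p :: "'a :: field poly"
  assumes "\<forall>q\<in>insert p S. monic q \<and> irreducible q" "p \<notin> S"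
  shows "\<not> p dvd (\<Prod>q\<in>S. q ^ e q)"
proof
  have prime: "prime_elem p"
    using assms(1) by (simp add: field_poly_irreducible_imp_prime)
  assume "p dvd (\<Prod>q\<in>S. q ^ e q)"
  then obtain q where "q \<in> S" "p dvd q ^ e q"
    using prime_elem_dvd_prodE[OF prime] by blast
  then have "p dvd q"
    using prime prime_elem_dvd_power by blast
  then show False
    using monic_irreducible_dvd_eq[of p q] assms \<open>q \<in> S\<close> by auto
qed

lemma prod_monic_irreducible_dvd:
  fixes P :: "'a :: field poly set"
  assumes "finite P" "\<forall>p\<in>P. monic p \<and> irreducible p \<and> p dvd g"
  shows "\<Prod>P dvd g"
  using assms
proof (induction P)
  case (insert p P)
  then obtain h where g_eq: "g = \<Prod>P * h"
    by auto
  have "\<not> p dvd \<Prod>P"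
    using monic_irreducible_not_dvd_prod_powers[of p P "\<lambda>_. 1"] insert by simp
  then have "p dvd h"
    using insert.prems field_poly_irreducible_imp_prime[of p]
    by (auto simp: g_eq prime_elem_dvd_mult_iff)
  then show ?case
    using insert.hyps by (simp add: g_eq mult.commute mult_dvd_mono)
qed simp

section \<open>Cancellation modulo an element\<close>

text \<open>For a nonzero polynomial \<open>f\<close> over a field, this means that \<open>a\<close> is invertible modulo \<open>f\<close>.\<close>

definition cancellable_mod :: "'a :: comm_semiring_1 \<Rightarrow> 'a \<Rightarrow> bool" where
  "cancellable_mod f a \<longleftrightarrow> (\<forall>b. f dvd a * b \<longrightarrow> f dvd b)"

lemma cancellable_modD: "cancellable_mod f a \<Longrightarrow> f dvd a * b \<Longrightarrow> f dvd b"
  unfolding cancellable_mod_def by blast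

lemma cancellable_mod_commute:
  fixes a b :: "'a :: idom"
  assumes "a \<noteq> 0" "cancellable_mod a b"
  shows "cancellable_mod b a"
  unfolding cancellable_mod_def
proof (intro allI impI)
  fix c
  assume "b dvd a * c"
  then obtain d where ac_eq: "a * c = b * d" ..
  then have "a dvd d"
    using cancellable_modD[OF assms(2), of d] by (metis dvd_triv_left)
  then obtain d' where "d = a * d'" ..
  then have "a * c = a * (b * d')"
    using ac_eq by (simp add: mult.left_commute)
  then show "b dvd c"
    using assms(1) by simp
qed

lemma cancellable_mod_prime_power:
  fixes p a :: "'a :: algebraic_semidom"
  assumes "prime_elem p" "\<not> p dvd a"
  shows "cancellable_mod (p ^ n) a"
  unfolding cancellable_mod_def
proof (intro allI impI)
  fix b
  assume "p ^ n dvd a * b"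
  then show "p ^ n dvd b"
    using prime_power_dvd_multD[OF assms(1), of n a b] assms(2) by (cases "n = 0") simp_all
qed

lemma not_prime_power_dvd_mult:
  fixes p a :: "'a :: idom"
  assumes "prime_elem p" "\<not> p dvd a" "i < n"
  shows "\<not> p ^ n dvd p ^ i * a"
proof
  assume "p ^ n dvd p ^ i * a"
  moreover have "n = i + Suc (n - i - 1)"
    using assms(3) by simp
  then have "p ^ n = p ^ i * (p * p ^ (n - i - 1))"
    by (metis power_Suc power_add)
  ultimately have "p * p ^ (n - i - 1) dvd a"
    using assms(1) by (simp add: prime_elem_not_zeroI)
  then show False
    using assms(2) dvd_mult_left by blast
qed

section \<open>Derivatives in characteristic two\<close>

lemma pderiv_mult_power_CHAR:
  fixes p q :: "'a :: idom poly"
  assumes "n = CHAR('a)"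
  shows "pderiv (p * q ^ n) = pderiv p * q ^ n"
proof -
  have "pderiv (q ^ n) = 0"
    by (simp add: pderiv_power assms of_nat_CHAR)
  then show ?thesis
    by (simp add: pderiv_mult mult.commute)
qed

lemma coeff_pderiv_even_char_2:
  fixes p :: "'a :: idom poly"
  assumes "CHAR('a) = 2"
  shows "coeff (pderiv p) (2 * i) = coeff p (Suc (2 * i))"
proof -
  have "of_nat (2 * i) = (0 :: 'a)"
    using assms by (subst of_nat_eq_0_iff_char_dvd) simp
  then show ?thesis
    by (simp add: coeff_pderiv del: of_nat_mult)
qed

lemma pderiv_pderiv_char_2:
  fixes p :: "'a :: idom poly"
  assumes "CHAR('a) = 2"
  shows "pderiv (pderiv p) = 0"
proof (rule poly_eqI)
  fix i
  have "of_nat (Suc i * Suc (Suc i)) = (0 :: 'a)"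
    by (subst of_nat_eq_0_iff_char_dvd) (simp add: assms)
  then have "of_nat (Suc i) * of_nat (Suc (Suc i)) = (0 :: 'a)"
    by (simp only: of_nat_mult)
  then show "coeff (pderiv (pderiv p)) i = coeff 0 i"
    by (simp only: coeff_pderiv coeff_0 mult_zero_left flip: mult.assoc)
qed

lemma pderiv_mult_power2_char_2:
  fixes p q :: "'a :: idom poly"
  assumes "CHAR('a) = 2"
  shows "pderiv (p * q\<^sup>2) = pderiv p * q\<^sup>2"
  by (rule pderiv_mult_power_CHAR) (simp add: assms)

lemma pderiv_mult_even_power_char_2:
  fixes p q :: "'a :: idom poly"
  assumes "CHAR('a) = 2"
  shows "pderiv (p * q ^ (2 * j)) = pderiv p * (q ^ j)\<^sup>2"
  using pderiv_mult_power2_char_2[OF assms, of p "q ^ j"]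
  by (simp add: power_mult[symmetric] mult.commute[of j])

section \<open>Symmetric bilinear forms in characteristic two\<close>

locale symmetric_bilinear_form = vector_space scale
  for scale :: "'a :: field \<Rightarrow> 'v :: ab_group_add \<Rightarrow> 'v" (infixr \<open>*s\<close> 75) +
  fixes form :: "'v \<Rightarrow> 'v \<Rightarrow> 'a"
  assumes form_commute: "form x y = form y x"
    and form_add_left: "form (x + y) z = form x z + form y z"
    and form_scale_left: "form (c *s x) y = c * form x y"
begin

lemma form_add_right: "form x (y + z) = form x y + form x z"
  by (simp add: form_commute[of x] form_add_left)

lemma form_scale_right: "form x (c *s y) = c * form x y"
  by (simp add: form_commute[of x] form_scale_left)

lemma form_zero_left [simp]: "form 0 y = 0"
  using form_scale_left[of 0 0 y] by simp

lemma form_diff_left: "form (x - y) z = form x z - form y z"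
  using form_add_left[of "x - y" y z] by simp

lemma form_sum_left: "form (\<Sum>i\<in>I. f i) y = (\<Sum>i\<in>I. form (f i) y)"
  by (induction I rule: infinite_finite_induct) (simp_all add: form_add_left)

definition orthonormal :: "'v set \<Rightarrow> bool" where
  "orthonormal E \<longleftrightarrow> (\<forall>v\<in>E. \<forall>w\<in>E. form v w = of_bool (v = w))"

lemma orthonormal_insert:
  assumes "orthonormal E" "form v v = 1" "\<forall>w\<in>E. form v w = 0"
  shows "orthonormal (insert v E)" "v \<notin> E"
proof -
  show "v \<notin> E"
    using assms(2,3) by auto
  moreover have "form w v = 0" if "w \<in> E" for w
    using assms(3) that by (metis form_commute)
  ultimately show "orthonormal (insert v E)"
    using assms by (auto simp: orthonormal_def)
qed

lemma form_sum_orthonormal: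
  assumes "orthonormal E" "finite E" "e \<in> E"
  shows "form (\<Sum>v\<in>E. c v *s v) e = c e"
proof -
  have "form (\<Sum>v\<in>E. c v *s v) e = (\<Sum>v\<in>E. if v = e then c v else 0)"
    using assms by (auto simp: form_sum_left form_scale_left orthonormal_def intro!: sum.cong)
  then show ?thesis
    using assms by simp
qed

lemma orthonormal_imp_independent:
  assumes "orthonormal E"
  shows "independent E"
proof (unfold independent_explicit_finite_subsets, intro allI impI ballI)
  fix S c e
  assume S: "S \<subseteq> E" "finite S" "(\<Sum>v\<in>S. c v *s v) = 0" "e \<in> S"
  then have "orthonormal S"
    using assms unfolding orthonormal_def by blast
  then show "c e = 0"
    using form_sum_orthonormal[of S e c] S by simp
qed

definition orth_proj :: "'v set \<Rightarrow> 'v \<Rightarrow> 'v" where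
  "orth_proj E x = (\<Sum>e\<in>E. form x e *s e)"

lemma form_diff_orth_proj:
  assumes "orthonormal E" "finite E" "e \<in> E"
  shows "form (x - orth_proj E x) e = 0"
  using form_sum_orthonormal[OF assms, of "form x"] by (simp add: form_diff_left orth_proj_def)

lemma form_orth_proj_eq_0:
  assumes "\<And>e. e \<in> E \<Longrightarrow> form e w = 0"
  shows "form (orth_proj E x) w = 0"
  using assms by (simp add: orth_proj_def form_sum_left form_scale_left)

definition maximal_orthonormal :: "'v set \<Rightarrow> bool" where
  "maximal_orthonormal E \<longleftrightarrow> finite E \<and> orthonormal E \<and>
    (\<forall>E'. finite E' \<longrightarrow> orthonormal E' \<longrightarrow> card E' \<le> card E)"

lemma maximal_orthonormalD:
  assumes "maximal_orthonormal E"
  shows "finite E" "orthonormal E" "\<And>E'. finite E' \<Longrightarrow> orthonormal E' \<Longrightarrow> card E' \<le> card E"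
  using assms by (auto simp: maximal_orthonormal_def)

lemma ex_maximal_orthonormal:
  assumes "\<And>E. finite E \<Longrightarrow> orthonormal E \<Longrightarrow> card E \<le> n"
  shows "\<exists>E. maximal_orthonormal E"
proof -
  have "finite {} \<and> orthonormal {}"
    by (simp add: orthonormal_def)
  moreover have "\<forall>E. finite E \<and> orthonormal E \<longrightarrow> card E < Suc n"
    using assms by (simp add: less_Suc_eq_le)
  ultimately show ?thesis
    unfolding maximal_orthonormal_def
    using ex_has_greatest_nat[of "\<lambda>E. finite E \<and> orthonormal E" "{}" card "Suc n"] by blast
qed

end

locale char_2_square_valued_form = symmetric_bilinear_form scale form
  for scale :: "'a :: field \<Rightarrow> 'v :: ab_group_add \<Rightarrow> 'v" (infixr \<open>*s\<close> 75)
    and form :: "'v \<Rightarrow> 'v \<Rightarrow> 'a" +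
  assumes char_2: "CHAR('a) = 2"
    and form_self_square: "\<exists>c. form x x = c\<^sup>2"
begin

lemma ex_scale_form_self_eq_1:
  assumes "form x x \<noteq> 0"
  shows "\<exists>c. form (c *s x) (c *s x) = 1"
proof -
  obtain c where form_x: "form x x = c\<^sup>2"
    using form_self_square by blast
  then have "form (inverse c *s x) (inverse c *s x) = 1"
    using assms by (simp add: form_scale_left form_scale_right power2_eq_square field_simps)
  then show ?thesis ..
qed

lemma isotropic_if_maximal_orthonormal:
  assumes E: "maximal_orthonormal E" and w: "\<And>e. e \<in> E \<Longrightarrow> form w e = 0"
  shows "form w w = 0"
proof (rule ccontr)
  assume "form w w \<noteq> 0"
  then obtain c where "form (c *s w) (c *s w) = 1"
    using ex_scale_form_self_eq_1 by blast
  moreover have "form (c *s w) e = 0" if "e \<in> E" for e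
    using w[OF that] by (simp add: form_scale_left)
  ultimately have "orthonormal (insert (c *s w) E)" "c *s w \<notin> E"
    using orthonormal_insert[OF maximal_orthonormalD(2)[OF E]] by blast+
  moreover from this have "card (insert (c *s w) E) = Suc (card E)"
    using maximal_orthonormalD(1)[OF E] by simp
  ultimately show False
    using maximal_orthonormalD(1)[OF E] maximal_orthonormalD(3)[OF E, of "insert (c *s w) E"]
    by simp
qed

lemma maximal_orthonormal_nonempty:
  assumes "maximal_orthonormal E" "form x x \<noteq> 0"
  shows "E \<noteq> {}"
  using isotropic_if_maximal_orthonormal[OF assms(1), of x] assms(2) by blast

text \<open>The key to diagonalization in characteristic two: a unit vector \<open>e\<close> and a hyperbolic pair
  \<open>w\<close>, \<open>v\<close> orthogonal to it span the same space as three orthonormal vectors.\<close>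

lemma orthonormal_replace_hyperbolic:
  assumes F: "finite F" "orthonormal (insert e F)" "e \<notin> F"
    and w: "\<And>u. u \<in> insert e F \<Longrightarrow> form w u = 0" "form w w = 0"
    and v: "\<And>u. u \<in> insert e F \<Longrightarrow> form v u = 0" "form v v = 0"
    and wv: "form w v = 1"
  shows "orthonormal ({e + w, e + v, e + w + v} \<union> F)"
    and "card ({e + w, e + v, e + w + v} \<union> F) = card F + 3"
proof -
  have orth_F: "orthonormal F"
    using F(2) by (simp add: orthonormal_def)
  have e: "form e e = 1" "\<And>u. u \<in> F \<Longrightarrow> form e u = 0"
    using F(2,3) by (auto simp: orthonormal_def)
  have cross: "form e w = 0" "form e v = 0" "form v w = 1"
    using w(1)[of e] v(1)[of e] wv by (simp_all add: form_commute[of e] form_commute[of v w])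
  have two: "(2 :: 'a) = 0"
    using of_nat_CHAR[where ?'a = 'a] by (simp add: char_2)
  then have three: "(3 :: 'a) = 1"
    by (subst eq_iff_diff_eq_0) simp
  let ?F_wv = "insert (e + w + v) F"
  let ?F_v = "insert (e + v) ?F_wv"
  let ?F_w = "insert (e + w) ?F_v"
  note form_values = form_add_left form_add_right e w v wv cross two three
  have orth_wv: "orthonormal ?F_wv" "e + w + v \<notin> F"
    using orthonormal_insert[OF orth_F, of "e + w + v"] by (simp_all add: form_values)
  have orth_v: "orthonormal ?F_v" "e + v \<notin> ?F_wv"
    using orthonormal_insert[OF orth_wv(1), of "e + v"] by (simp_all add: form_values)
  have orth_w: "orthonormal ?F_w" "e + w \<notin> ?F_v"
    using orthonormal_insert[OF orth_v(1), of "e + w"] by (simp_all add: form_values)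
  have insert_eq: "{e + w, e + v, e + w + v} \<union> F = ?F_w"
    by simp
  show "orthonormal ({e + w, e + v, e + w + v} \<union> F)"
    unfolding insert_eq by (rule orth_w(1))
  show "card ({e + w, e + v, e + w + v} \<union> F) = card F + 3"
    unfolding insert_eq using F(1) orth_wv(2) orth_v(2) orth_w(2) by simp
qed

lemma form_eq_0_if_maximal_orthonormal:
  assumes E: "maximal_orthonormal E" "E \<noteq> {}"
    and w: "\<And>e. e \<in> E \<Longrightarrow> form w e = 0" and w': "\<And>e. e \<in> E \<Longrightarrow> form w' e = 0"
  shows "form w w' = 0"
proof (rule ccontr)
  assume "form w w' \<noteq> 0"
  define v where "v = inverse (form w w') *s w'"
  have wv: "form w v = 1"
    using \<open>form w w' \<noteq> 0\<close> by (simp add: v_def form_scale_right)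
  have v: "form v e = 0" if "e \<in> E" for e
    using w'[OF that] by (simp add: v_def form_scale_left)
  have isotropic: "form w w = 0" "form v v = 0"
    using isotropic_if_maximal_orthonormal[OF E(1)] w v by blast+
  obtain e F where E_eq: "E = insert e F" "e \<notin> F"
    using E(2) by (meson ex_in_conv mk_disjoint_insert)
  have F: "finite F" "orthonormal (insert e F)"
    using maximal_orthonormalD(1,2)[OF E(1)] E_eq by simp_all
  let ?E' = "{e + w, e + v, e + w + v} \<union> F"
  have "orthonormal ?E'" "card ?E' = card F + 3"
    using w v unfolding E_eq(1)
    by (intro orthonormal_replace_hyperbolic[OF F E_eq(2) _ isotropic(1) _ isotropic(2) wv];
        blast)+
  moreover from this(1) have "card ?E' \<le> card E"
    using F(1) by (intro maximal_orthonormalD(3)[OF E(1)]) simp_all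
  ultimately show False
    using F(1) by (simp add: E_eq)
qed

lemma form_diff_orth_proj_eq_0:
  assumes E: "maximal_orthonormal E" "E \<noteq> {}"
  shows "form (x - orth_proj E x) y = 0"
proof -
  let ?w = "\<lambda>x. x - orth_proj E x"
  have w: "form (?w x) e = 0" if "e \<in> E" for x e
    using form_diff_orth_proj that maximal_orthonormalD(1,2)[OF E(1)] by blast
  have "form (?w x) y = form (?w y) (?w x) + form (orth_proj E y) (?w x)"
    by (simp add: form_diff_left form_commute[of _ y])
  also have "form (?w y) (?w x) = 0"
    using form_eq_0_if_maximal_orthonormal[OF E] w by blast
  also have "form (orth_proj E y) (?w x) = 0"
    by (rule form_orth_proj_eq_0) (metis w form_commute)
  finally show ?thesis
    by simp
qed

end

section \<open>Residue forms on polynomials\<close>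

lemma coeff_mult_add_degree_le:
  fixes p q :: "'a :: comm_semiring_0 poly"
  assumes "degree p \<le> a" "degree q \<le> b"
  shows "coeff (p * q) (a + b) = coeff p a * coeff q b"
proof (cases "degree p = a \<and> degree q = b")
  case True
  then show ?thesis
    using coeff_mult_degree_sum[of p q] by simp
next
  case False
  then have "degree (p * q) < a + b"
    using assms degree_mult_le[of p q] by linarith
  then show ?thesis
    using False assms by (auto simp: coeff_eq_0)
qed

lemma degree_mod_less_if_degree_ge_1:
  fixes f g :: "'a :: field poly"
  assumes "degree f \<ge> 1"
  shows "degree (g mod f) < degree f"
  using assms degree_mod_less'[of f g] by fastforce

lemma eq_if_dvd_diff_degree_less:
  fixes p q m :: "'a :: idom poly"
  assumes "m dvd p - q" "degree p < degree m" "degree q < degree m"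
  shows "p = q"
proof (rule ccontr)
  assume "p \<noteq> q"
  then have "degree m \<le> degree (p - q)"
    using assms(1) by (intro dvd_imp_degree_le) simp_all
  then show False
    using degree_diff_less[OF assms(2,3)] by simp
qed

text \<open>The coefficient of \<open>X\<^sup>-\<^sup>1\<close> in the Laurent series of \<open>g / f\<close> at infinity, for monic \<open>f\<close>.\<close>

definition residue_at_infinity :: "'a :: field poly \<Rightarrow> 'a poly \<Rightarrow> 'a" where
  "residue_at_infinity f g = coeff (g mod f) (degree f - 1)"

lemma residue_at_infinity_add:
  "residue_at_infinity f (g + h) = residue_at_infinity f g + residue_at_infinity f h"
  by (simp add: residue_at_infinity_def poly_mod_add_left)

lemma residue_at_infinity_smult:
  "residue_at_infinity f (Polynomial.smult c g) = c * residue_at_infinity f g"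
  by (simp add: residue_at_infinity_def mod_smult_left)

lemma residue_at_infinity_nondegenerate:
  assumes "f \<noteq> 0" "\<not> f dvd g"
  obtains h where "residue_at_infinity f (g * h) \<noteq> 0"
proof
  let ?g = "g mod f"
  let ?h = "monom 1 (degree f - 1 - degree ?g) :: 'a poly"
  have "?g \<noteq> 0"
    using assms(2) by (simp add: dvd_eq_mod_eq_0)
  then have "degree ?g < degree f"
    using degree_mod_less' assms(1) by blast
  then have deg: "degree (?g * ?h) = degree f - 1" "degree (?g * ?h) < degree f"
    using \<open>?g \<noteq> 0\<close> by (simp_all add: degree_mult_eq degree_monom_eq)
  have "residue_at_infinity f (g * ?h) = coeff (?g * ?h) (degree f - 1)"
    using deg(2) by (metis residue_at_infinity_def mod_mult_left_eq mod_poly_less)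
  also have "\<dots> \<noteq> 0"
    using \<open>?g \<noteq> 0\<close> by (metis deg(1) leading_coeff_0_iff monom_eq_0_iff mult_eq_0_iff one_neq_zero)
  finally show "residue_at_infinity f (g * ?h) \<noteq> 0" .
qed

lemma pderiv_mod_mult_eq_power2:
  fixes f r s g :: "'a :: field poly"
  assumes char: "CHAR('a) = 2" and f: "degree f \<ge> 1" and deriv: "pderiv (r * f) = s\<^sup>2"
  shows "pderiv ((r * g\<^sup>2) mod f * f) = ((s * g) mod f)\<^sup>2"
proof -
  define t w where "t = (r * g\<^sup>2) mod f" and "w = (s * g) mod f"
  obtain c a where division: "r * g\<^sup>2 = c * f + t" "s * g = a * f + w"
    unfolding t_def w_def by (metis div_mult_mod_eq)
  have "(r * f) * g\<^sup>2 = (r * g\<^sup>2) * f"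
    by (simp only: mult_ac)
  also have "\<dots> = c * f\<^sup>2 + t * f"
    unfolding division(1) by (simp add: algebra_simps power2_eq_square)
  finally have "pderiv c * f\<^sup>2 + pderiv (t * f) = pderiv ((r * f) * g\<^sup>2)"
    by (simp add: pderiv_add pderiv_mult_power2_char_2[OF char])
  also have "\<dots> = (s * g)\<^sup>2"
    by (simp add: pderiv_mult_power2_char_2[OF char] deriv power_mult_distrib)
  also have "\<dots> = a\<^sup>2 * f\<^sup>2 + w\<^sup>2"
    unfolding division(2) using char by (subst freshmans_dream) (simp_all add: power_mult_distrib)
  finally have diff: "pderiv (t * f) - w\<^sup>2 = (a\<^sup>2 - pderiv c) * f\<^sup>2"
    by (simp add: algebra_simps)
  have less: "degree t < degree f" "degree w < degree f"
    using f by (simp_all add: t_def w_def degree_mod_less_if_degree_ge_1)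
  have "f \<noteq> 0"
    using f by auto
  then have deg: "degree (f\<^sup>2) = 2 * degree f"
    by (simp add: degree_power_eq)
  have "pderiv (t * f) = w\<^sup>2"
  proof (rule eq_if_dvd_diff_degree_less)
    show "f\<^sup>2 dvd pderiv (t * f) - w\<^sup>2"
      unfolding diff by simp
    show "degree (pderiv (t * f)) < degree (f\<^sup>2)"
      using less(1) degree_mult_le[of t f] degree_pderiv_le[of "t * f"] deg by linarith
    show "degree (w\<^sup>2) < degree (f\<^sup>2)"
      using less(2) degree_power_le[of w 2] deg by linarith
  qed
  then show ?thesis
    by (simp add: t_def w_def)
qed

lemma residue_at_infinity_mult_power2:
  fixes f r s g :: "'a :: field poly"
  assumes char: "CHAR('a) = 2" and f: "monic f" "degree f \<ge> 1" and deriv: "pderiv (r * f) = s\<^sup>2"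
  shows "residue_at_infinity f (r * g\<^sup>2) = (residue_at_infinity f (s * g))\<^sup>2"
proof -
  define t w where "t = (r * g\<^sup>2) mod f" and "w = (s * g) mod f"
  let ?m = "degree f - 1"
  have deg: "degree t \<le> ?m" "degree w \<le> ?m"
    unfolding t_def w_def
    using degree_mod_less_if_degree_ge_1[OF f(2), of "r * g\<^sup>2"]
      degree_mod_less_if_degree_ge_1[OF f(2), of "s * g"] by linarith+
  have "coeff t ?m = coeff (t * f) (?m + degree f)"
    using coeff_mult_add_degree_le[OF deg(1) order_refl] f(1) by simp
  also have "?m + degree f = Suc (2 * ?m)"
    using f(2) by simp
  also have "coeff (t * f) (Suc (2 * ?m)) = coeff (w\<^sup>2) (2 * ?m)"
    using pderiv_mod_mult_eq_power2[OF char f(2) deriv]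
    by (simp add: t_def w_def flip: coeff_pderiv_even_char_2[OF char])
  also have "\<dots> = (coeff w ?m)\<^sup>2"
    using coeff_mult_add_degree_le[OF deg(2) deg(2)] by (simp add: power2_eq_square mult_2)
  finally show ?thesis
    by (simp add: residue_at_infinity_def t_def w_def)
qed

definition residue_form :: "'a :: field poly \<Rightarrow> 'a poly \<Rightarrow> 'a poly \<Rightarrow> 'a poly \<Rightarrow> 'a" where
  "residue_form f r g h = residue_at_infinity f (r * g * h)"

lemma residue_form_mult: "residue_form f r (p * g) h = residue_form f r g (p * h)"
  by (simp add: residue_form_def mult_ac)

lemma residue_form_mod: "residue_form f r (g mod f) (h mod f) = residue_form f r g h"
  unfolding residue_form_def residue_at_infinity_def
  by (metis mod_mult_left_eq mod_mult_right_eq mult.assoc)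

interpretation residue_form: symmetric_bilinear_form Polynomial.smult "residue_form f r"
  for f r :: "'a :: field poly"
  by unfold_locales
    (simp_all add: smult_add_right smult_add_left residue_form_def residue_at_infinity_add
      residue_at_infinity_smult ring_distribs mult_ac)

lemma dvd_if_residue_form_eq_0:
  assumes "f \<noteq> 0" "cancellable_mod f r" "\<And>h. residue_form f r g h = 0"
  shows "f dvd g"
proof (rule ccontr)
  assume "\<not> f dvd g"
  then have "\<not> f dvd r * g"
    using assms(2) unfolding cancellable_mod_def by blast
  then obtain h where "residue_at_infinity f (r * g * h) \<noteq> 0"
    by (rule residue_at_infinity_nondegenerate[OF assms(1)])
  then show False
    using assms(3)[of h] by (simp add: residue_form_def)
qed

lemma mod_in_span_monoms:
  fixes f g :: "'a :: field poly"
  assumes f: "degree f \<ge> 1"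
  shows "g mod f \<in> residue_form.span (monom 1 ` {..<degree f})"
proof -
  have "degree (g mod f) \<le> degree f - 1"
    using degree_mod_less_if_degree_ge_1[OF f, of g] by linarith
  then have "g mod f = (\<Sum>i\<le>degree f - 1. monom (coeff (g mod f) i) i)"
    by (rule poly_as_sum_of_monoms'[symmetric])
  also have "\<dots> = (\<Sum>i\<le>degree f - 1. Polynomial.smult (coeff (g mod f) i) (monom 1 i))"
    by (simp add: smult_monom)
  also have "\<dots> \<in> residue_form.span (monom 1 ` {..<degree f})"
    using f by (intro residue_form.span_sum residue_form.span_scale residue_form.span_base) auto
  finally show ?thesis .
qed

lemma card_orthonormal_residue_form_le:
  fixes f r :: "'a :: field poly"
  assumes f: "degree f \<ge> 1" and E: "residue_form.orthonormal f r E" "finite E"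
  shows "card E \<le> degree f"
proof -
  let ?mod = "\<lambda>g. g mod f"
  let ?monoms = "monom 1 ` {..<degree f} :: 'a poly set"
  have form_eq: "residue_form f r v w = of_bool (v = w)" if "v \<in> E" "w \<in> E" for v w
    using E(1) that by (simp add: residue_form.orthonormal_def)
  have inj: "inj_on ?mod E"
  proof (rule inj_onI)
    fix v w
    assume vw: "v \<in> E" "w \<in> E" "v mod f = w mod f"
    then have "residue_form f r v w = residue_form f r v v"
      by (metis residue_form_mod)
    then show "v = w"
      using form_eq vw(1,2) by (auto split: if_splits)
  qed
  have "residue_form.orthonormal f r (?mod ` E)"
    using form_eq
    by (auto simp: residue_form.orthonormal_def residue_form_mod dest: inj_onD[OF inj])
  then have "residue_form.independent (?mod ` E)"
    by (rule residue_form.orthonormal_imp_independent)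
  moreover have "?mod ` E \<subseteq> residue_form.span ?monoms"
    using mod_in_span_monoms[OF f] by blast
  ultimately have "card (?mod ` E) \<le> card ?monoms"
    by (metis finite_imageI finite_lessThan residue_form.independent_span_bound)
  also have "\<dots> \<le> degree f"
    using card_image_le[of "{..<degree f}"] by simp
  finally show ?thesis
    using inj by (simp add: card_image)
qed

lemma char_poly_eq_if_mult_X_mod:
  fixes f :: "'a :: field poly"
  assumes C: "C \<in> carrier_mat m m" and f: "monic f" "m \<le> degree f"
    and X: "\<And>j. j < m \<Longrightarrow> f dvd [:0, 1:] * e j - (\<Sum>i<m. Polynomial.smult (C $$ (i, j)) (e i))"
    and one: "f dvd 1 - (\<Sum>i<m. Polynomial.smult (c i) (e i))"
  shows "char_poly C = f"
proof -
  let ?M = "char_poly_matrix C" and ?\<chi> = "char_poly C"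
  have "(\<Sum>i<m. e i * ?M $$ (i, j)) =
      [:0, 1:] * e j - (\<Sum>i<m. Polynomial.smult (C $$ (i, j)) (e i))" if "j < m" for j
  proof -
    have "(\<Sum>i<m. e i * ?M $$ (i, j)) =
        (\<Sum>i<m. (if i = j then [:0, 1:] * e i else 0) - Polynomial.smult (C $$ (i, j)) (e i))"
      using that by (intro sum.cong refl) (auto simp: char_poly_matrix_index[OF C] algebra_simps)
    then show ?thesis
      using that by (simp add: sum_subtractf)
  qed
  then have "f dvd ?\<chi> * e k" if "k < m" for k
    unfolding char_poly_def using X C that by (intro dvd_det_mult[of _ m]) auto
  then have "f dvd (\<Sum>i<m. Polynomial.smult (c i) (?\<chi> * e i))"
    by (intro dvd_sum dvd_smult) auto
  then have "f dvd ?\<chi> * (\<Sum>i<m. Polynomial.smult (c i) (e i))"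
    by (simp add: sum_distrib_left)
  moreover have "f dvd ?\<chi> * (1 - (\<Sum>i<m. Polynomial.smult (c i) (e i)))"
    using one by (rule dvd_mult)
  ultimately have "f dvd ?\<chi> * (\<Sum>i<m. Polynomial.smult (c i) (e i)) +
      ?\<chi> * (1 - (\<Sum>i<m. Polynomial.smult (c i) (e i)))"
    by (rule dvd_add)
  then have "f dvd ?\<chi>"
    by (simp add: right_diff_distrib)
  then show ?thesis
    using degree_monic_char_poly[OF C] f by (metis monic_dvd_eq)
qed

definition square_multiplier :: "'a :: idom poly \<Rightarrow> 'a poly \<Rightarrow> 'a poly \<Rightarrow> bool" where
  "square_multiplier f r s \<longleftrightarrow> cancellable_mod f r \<and> pderiv (r * f) = s\<^sup>2"

lemma residue_form_self:
  fixes f r s :: "'a :: field poly"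
  assumes "CHAR('a) = 2" "monic f" "degree f \<ge> 1" "square_multiplier f r s"
  shows "residue_form f r g g = (residue_at_infinity f (s * g))\<^sup>2"
  using residue_at_infinity_mult_power2[of f r s g] assms
  by (simp add: residue_form_def square_multiplier_def power2_eq_square mult.assoc)

lemma residue_form_orthonormal_expansion:
  fixes f r s :: "'a :: field poly"
  assumes char: "CHAR('a) = 2" and f: "monic f" "degree f \<ge> 1"
    and r: "square_multiplier f r s" and s: "\<not> f dvd s"
  obtains m and e :: "nat \<Rightarrow> 'a poly" where "m \<le> degree f"
    and "\<And>g. f dvd g - (\<Sum>i<m. Polynomial.smult (residue_form f r g (e i)) (e i))"
proof -
  have "f \<noteq> 0" and cancellable: "cancellable_mod f r"
    using f r by (auto simp: square_multiplier_def)
  note form_self = residue_form_self[OF char f r]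
  interpret square_valued: char_2_square_valued_form Polynomial.smult "residue_form f r"
    by unfold_locales (use char form_self in auto)
  obtain E where E: "residue_form.maximal_orthonormal f r E"
    using residue_form.ex_maximal_orthonormal card_orthonormal_residue_form_le[OF f(2)] by metis
  note orthonormal_E = residue_form.maximal_orthonormalD(1,2)[OF E]
  obtain h where "residue_at_infinity f (s * h) \<noteq> 0"
    using residue_at_infinity_nondegenerate[OF \<open>f \<noteq> 0\<close> s] .
  then have "residue_form f r h h \<noteq> 0"
    by (simp add: form_self)
  then have "E \<noteq> {}"
    using square_valued.maximal_orthonormal_nonempty[OF E] by blast
  obtain e where e: "bij_betw e {..<card E} E"
    using ex_bij_betw_nat_finite[OF orthonormal_E(1)] by (auto simp: lessThan_atLeast0)
  show thesis
  proof (rule that[of "card E" e])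
    show "card E \<le> degree f"
      using card_orthonormal_residue_form_le[OF f(2) orthonormal_E(2,1)] .
    fix g
    have "f dvd g - residue_form.orth_proj f r E g"
      using dvd_if_residue_form_eq_0[OF \<open>f \<noteq> 0\<close> cancellable]
        square_valued.form_diff_orth_proj_eq_0[OF E \<open>E \<noteq> {}\<close>] by blast
    also have "residue_form.orth_proj f r E g =
        (\<Sum>i<card E. Polynomial.smult (residue_form f r g (e i)) (e i))"
      unfolding residue_form.orth_proj_def by (rule sum.reindex_bij_betw[OF e, symmetric])
    finally show "f dvd g - (\<Sum>i<card E. Polynomial.smult (residue_form f r g (e i)) (e i))" .
  qed
qed

lemma ex_symmetric_mat_if_square_multiplier:
  fixes f r s :: "'a :: field poly"
  assumes "CHAR('a) = 2" "monic f" "degree f \<ge> 1" "square_multiplier f r s" "\<not> f dvd s"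
  shows "\<exists>C\<in>carrier_mat (degree f) (degree f). symmetric_mat C \<and> char_poly C = f"
proof -
  obtain m e where m: "m \<le> degree f"
    and expansion: "\<And>g. f dvd g - (\<Sum>i<m. Polynomial.smult (residue_form f r g (e i)) (e i))"
    using residue_form_orthonormal_expansion[OF assms] by blast
  define C where "C = mat m m (\<lambda>(i, j). residue_form f r ([:0, 1:] * e j) (e i))"
  have C: "C \<in> carrier_mat m m"
    by (simp add: C_def)
  have "char_poly C = f"
  proof (rule char_poly_eq_if_mult_X_mod[OF C assms(2) m _ expansion[of 1]])
    fix j
    assume "j < m"
    then show "f dvd [:0, 1:] * e j - (\<Sum>i<m. Polynomial.smult (C $$ (i, j)) (e i))"
      using expansion[of "[:0, 1:] * e j"] by (simp add: C_def)
  qed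
  moreover from this have "m = degree f"
    using degree_monic_char_poly[OF C] by simp
  moreover have "residue_form f r ([:0, 1:] * g) h = residue_form f r ([:0, 1:] * h) g" for g h
    by (metis residue_form_mult residue_form.form_commute)
  then have "symmetric_mat C"
    unfolding symmetric_mat_def by (intro eq_matI) (simp_all add: C_def)
  ultimately show ?thesis
    using C by blast
qed

section \<open>Existence of multipliers\<close>

lemma dvd_if_dvd_cross_sum:
  fixes f g a b :: "'a :: idom"
  assumes "f \<noteq> 0" "cancellable_mod f g" "f * g dvd a * g + b * f"
  shows "f dvd a" "g dvd b"
proof -
  have "f dvd a * g + b * f" "g dvd a * g + b * f"
    using assms(3) dvd_mult_left dvd_mult_right by blast+
  then have "f dvd g * a" "g dvd f * b"
    by (simp_all add: dvd_add_left_iff dvd_add_right_iff mult.commute)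
  then show "f dvd a" "g dvd b"
    using cancellable_modD assms(2) cancellable_mod_commute[OF assms(1,2)] by blast+
qed

lemma cancellable_mod_mult_cross_sum:
  fixes f g r t :: "'a :: idom"
  assumes fg: "f \<noteq> 0" "cancellable_mod f g"
    and r: "cancellable_mod f r" and t: "cancellable_mod g t"
  shows "cancellable_mod (f * g) (r * g + t * f)"
  unfolding cancellable_mod_def
proof (intro allI impI)
  fix h
  assume "f * g dvd (r * g + t * f) * h"
  then have "f * g dvd (r * h) * g + (t * h) * f"
    by (simp add: algebra_simps)
  then have "f dvd r * h" "g dvd t * h"
    using dvd_if_dvd_cross_sum[OF fg] by blast+
  then have "f dvd h" "g dvd h"
    using r t cancellable_modD by blast+
  from this(1) obtain k where h_eq: "h = f * k" ..
  then have "g dvd k"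
    using \<open>g dvd h\<close> cancellable_modD[OF cancellable_mod_commute[OF fg]] by blast
  then show "f * g dvd h"
    unfolding h_eq by (rule mult_dvd_mono[OF dvd_refl])
qed

text \<open>The new multiplier is the numerator of \<open>r / f + t / g\<close>. The condition on \<open>r\<close> says that the
  derivative of \<open>r / f\<close> is \<open>(s / f)\<^sup>2\<close>, and squaring is additive.\<close>

lemma square_multiplier_mult:
  fixes f g :: "'a :: idom poly"
  assumes char: "CHAR('a) = 2" and fg: "f \<noteq> 0" "cancellable_mod f g"
    and r: "square_multiplier f r s" and t: "square_multiplier g t u"
  shows "square_multiplier (f * g) (r * g + t * f) (s * g + u * f)"
proof -
  have "(r * g + t * f) * (f * g) = (r * f) * g\<^sup>2 + (t * g) * f\<^sup>2"
    by (simp add: algebra_simps power2_eq_square)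
  then have "pderiv ((r * g + t * f) * (f * g)) = s\<^sup>2 * g\<^sup>2 + u\<^sup>2 * f\<^sup>2"
    using r t by (simp only: pderiv_add pderiv_mult_power2_char_2[OF char] square_multiplier_def)
  also have "\<dots> = (s * g + u * f)\<^sup>2"
    using char by (subst freshmans_dream) (simp_all add: power_mult_distrib)
  finally show ?thesis
    using cancellable_mod_mult_cross_sum[OF fg] r t unfolding square_multiplier_def by blast
qed

lemma square_multiplier_even_power:
  fixes p :: "'a :: field poly"
  assumes char: "CHAR('a) = 2" and p: "irreducible p"
  obtains r where "square_multiplier (p ^ (2 * j)) r (p ^ j)"
proof -
  have "\<not> (p dvd [:0, 1:] \<and> p dvd [:1, 1:])"
  proof
    assume "p dvd [:0, 1:] \<and> p dvd [:1, 1:]"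
    then have "p dvd [:1, 1:] - [:0, 1:]"
      by (blast intro: dvd_diff)
    then show False
      using p by (simp add: irreducible_def flip: one_pCons)
  qed
  then obtain r where r: "\<not> p dvd r" "r = [:0, 1:] \<or> r = [:1, 1:]"
    by blast
  then have "pderiv (r * p ^ (2 * j)) = (p ^ j)\<^sup>2"
    by (auto simp: pderiv_mult_even_power_char_2[OF char] pderiv_pCons)
  then show thesis
    using that cancellable_mod_prime_power[OF field_poly_irreducible_imp_prime[OF p] r(1)]
    by (auto simp: square_multiplier_def)
qed

lemma square_multiplier_odd_power_separable:
  fixes p :: "'a :: field poly"
  assumes char: "CHAR('a) = 2" and p: "irreducible p" "pderiv p \<noteq> 0"
  shows "square_multiplier (p ^ (2 * j + 1)) (pderiv p) (p ^ j * pderiv p)"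
proof -
  have "pderiv (pderiv p * p) = (pderiv p)\<^sup>2"
    by (simp add: pderiv_mult pderiv_pderiv_char_2[OF char] power2_eq_square)
  have "pderiv (pderiv p * p ^ (2 * j + 1)) = pderiv ((pderiv p * p) * p ^ (2 * j))"
    by (simp add: mult_ac)
  also have "\<dots> = pderiv (pderiv p * p) * (p ^ j)\<^sup>2"
    by (rule pderiv_mult_even_power_char_2[OF char])
  also have "\<dots> = (p ^ j * pderiv p)\<^sup>2"
    unfolding \<open>pderiv (pderiv p * p) = (pderiv p)\<^sup>2\<close>
    by (simp add: power_mult_distrib mult.commute)
  finally show ?thesis
    using cancellable_mod_prime_power[OF field_poly_irreducible_imp_prime[OF p(1)]
        not_dvd_pderiv_if_nonzero[OF p(2)]]
    unfolding square_multiplier_def by blast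
qed

lemma square_multiplier_odd_power_inseparable:
  fixes p :: "'a :: field poly"
  assumes char: "CHAR('a) = 2" and p: "irreducible p" "pderiv p = 0"
  shows "square_multiplier (p ^ (2 * j + 1)) ([:0, 1:] * p + 1) (p ^ (j + 1))"
proof -
  let ?r = "[:0, 1:] * p + 1"
  have "\<not> p dvd ?r"
    using irreducible_not_unit[OF p(1)] dvd_add_right_iff[OF dvd_triv_right] by blast
  then have cancellable: "cancellable_mod (p ^ (2 * j + 1)) ?r"
    by (intro cancellable_mod_prime_power field_poly_irreducible_imp_prime p(1))
  have "pderiv ?r = p"
    using p(2) by (simp add: pderiv_add pderiv_mult pderiv_pCons)
  have "pderiv (?r * p ^ (2 * j + 1)) = pderiv ((?r * p) * p ^ (2 * j))"
    by (simp only: mult_ac power_add power_one_right)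
  also have "\<dots> = (pderiv ?r * p) * (p ^ j)\<^sup>2"
    using p(2) by (simp only: pderiv_mult_even_power_char_2[OF char] pderiv_mult[of ?r]
        mult_zero_right add_0 mult.commute[of p])
  also have "\<dots> = (p ^ (j + 1))\<^sup>2"
    unfolding \<open>pderiv ?r = p\<close> by (simp add: power2_eq_square mult_ac)
  finally show ?thesis
    using cancellable unfolding square_multiplier_def by blast
qed

lemma ex_square_multiplier_prime_power:
  fixes p :: "'a :: field poly"
  assumes char: "CHAR('a) = 2" and p: "irreducible p" and n: "n \<ge> 1"
  shows "\<exists>r s. square_multiplier (p ^ n) r s \<and> (pderiv p \<noteq> 0 \<or> n \<ge> 2 \<longrightarrow> \<not> p ^ n dvd s)"
proof -
  note prime = field_poly_irreducible_imp_prime[OF p]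
  have "\<not> p dvd 1"
    using p by (rule irreducible_not_unit)
  then have not_dvd: "\<not> p ^ n dvd p ^ i" if "i < n" for i
    using not_prime_power_dvd_mult[OF prime _ that, of 1] by simp
  consider (even) j where "n = 2 * j"
    | (separable) j where "n = 2 * j + 1" "pderiv p \<noteq> 0"
    | (inseparable) j where "n = 2 * j + 1" "pderiv p = 0"
    by (metis evenE oddE)
  then show ?thesis
  proof cases
    case even
    then have "\<not> p ^ n dvd p ^ j"
      using n by (intro not_dvd) simp
    then show ?thesis
      using square_multiplier_even_power[OF char p, of j] even by blast
  next
    case separable
    then have "\<not> p ^ n dvd p ^ j * pderiv p"
      by (intro not_prime_power_dvd_mult[OF prime] not_dvd_pderiv_if_nonzero) simp_all
    then show ?thesis
      using square_multiplier_odd_power_separable[OF char p] separable by blast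
  next
    case inseparable
    then have "\<not> p ^ n dvd p ^ (j + 1)" if "n \<ge> 2"
      using that by (intro not_dvd) simp
    then show ?thesis
      using square_multiplier_odd_power_inseparable[OF char p] inseparable by blast
  qed
qed

lemma ex_square_multiplier:
  fixes S :: "'a :: field poly set"
  assumes char: "CHAR('a) = 2" and "finite S" "\<forall>p\<in>S. monic p \<and> irreducible p"
    and "\<forall>p\<in>S. e p \<ge> 1"
  defines "f \<equiv> \<Prod>p\<in>S. p ^ e p"
  shows "\<exists>r s. square_multiplier f r s \<and> ((\<exists>p\<in>S. pderiv p \<noteq> 0 \<or> e p \<ge> 2) \<longrightarrow> \<not> f dvd s)"
  unfolding f_def using assms(2-4)
proof (induction S)
  case empty
  have "square_multiplier 1 1 (0 :: 'a poly)"
    by (simp add: square_multiplier_def cancellable_mod_def)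
  then show ?case
    by auto
next
  case (insert p S)
  let ?g = "\<Prod>q\<in>S. q ^ e q"
  obtain r s where r: "square_multiplier ?g r s" "(\<exists>q\<in>S. pderiv q \<noteq> 0 \<or> e q \<ge> 2) \<longrightarrow> \<not> ?g dvd s"
    using insert by auto
  obtain t u where t: "square_multiplier (p ^ e p) t u" "pderiv p \<noteq> 0 \<or> e p \<ge> 2 \<longrightarrow> \<not> p ^ e p dvd u"
    using ex_square_multiplier_prime_power[OF char, of p "e p"] insert.prems by auto
  have prime: "prime_elem p"
    using insert.prems(1) by (simp add: field_poly_irreducible_imp_prime)
  have coprime: "p ^ e p \<noteq> 0" "cancellable_mod (p ^ e p) ?g"
    using prime_elem_not_zeroI[OF prime] cancellable_mod_prime_power[OF prime
        monic_irreducible_not_dvd_prod_powers[OF insert.prems(1) insert.hyps(2)]] by simp_all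
  have "\<not> p ^ e p * ?g dvd u * ?g + s * p ^ e p" if "\<exists>q\<in>insert p S. pderiv q \<noteq> 0 \<or> e q \<ge> 2"
  proof
    assume "p ^ e p * ?g dvd u * ?g + s * p ^ e p"
    then have "p ^ e p dvd u" "?g dvd s"
      by (rule dvd_if_dvd_cross_sum[OF coprime])+
    then show False
      using r(2) t(2) that by blast
  qed
  then show ?case
    unfolding prod.insert[OF insert.hyps]
    using square_multiplier_mult[OF char coprime t(1) r(1)] by blast
qed

section \<open>The characterization\<close>

definition distinct_inseparable_product :: "'a :: field poly \<Rightarrow> bool" where
  "distinct_inseparable_product f \<longleftrightarrow>
    (\<exists>P. finite P \<and> (\<forall>p\<in>P. monic p \<and> irreducible p \<and> inseparable_poly p) \<and> f = \<Prod>P)"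

lemma symmetric_char_poly_not_distinct_inseparable_product:
  fixes A :: "'a :: field mat"
  assumes "CHAR('a) = 2" "A \<in> carrier_mat n n" "n \<ge> 1" "symmetric_mat A"
  shows "\<not> distinct_inseparable_product (char_poly A)"
proof
  assume "distinct_inseparable_product (char_poly A)"
  then obtain P where P: "finite P" "\<forall>p\<in>P. monic p \<and> irreducible p \<and> pderiv p = 0"
    "char_poly A = \<Prod>P"
    unfolding distinct_inseparable_product_def using inseparable_poly_iff_pderiv_eq_0 by blast
  then have "pderiv (char_poly A) = 0"
    by (simp add: pderiv_prod)
  then obtain g where g: "char_poly A dvd g\<^sup>2" "\<not> char_poly A dvd g"
    using symmetric_char_poly_dvd_power2_not_dvd assms by metis
  have "p dvd g" if "p \<in> P" for p
  proof -
    have "p dvd char_poly A"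
      using P(1,3) that dvd_prodI[of P p "\<lambda>q. q"] by simp
    then have "p dvd g\<^sup>2"
      using g(1) by (rule dvd_trans)
    moreover have "prime_elem p"
      using P(2) that by (simp add: field_poly_irreducible_imp_prime)
    ultimately show ?thesis
      by (rule prime_elem_dvd_power[rotated])
  qed
  then have "char_poly A dvd g"
    unfolding P(3) using P(1,2) by (intro prod_monic_irreducible_dvd) blast+
  then show False
    using g(2) by blast
qed

lemma ex_symmetric_mat_if_not_distinct_inseparable_product:
  fixes f :: "'a :: field poly"
  assumes char: "CHAR('a) = 2" and f: "monic f" "degree f \<ge> 1" "\<not> distinct_inseparable_product f"
  shows "\<exists>A\<in>carrier_mat (degree f) (degree f). symmetric_mat A \<and> char_poly A = f"
proof -
  obtain S k where S: "finite S" "f = (\<Prod>p\<in>S. p ^ Suc (k p))" "\<forall>p\<in>S. monic p \<and> irreducible p"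
    using monic_irreducible_factorization[OF f(1)] by auto
  obtain r s where rs: "square_multiplier f r s"
    "(\<exists>p\<in>S. pderiv p \<noteq> 0 \<or> Suc (k p) \<ge> 2) \<longrightarrow> \<not> f dvd s"
    using ex_square_multiplier[OF char S(1,3), of "\<lambda>p. Suc (k p)"] by (auto simp: S(2))
  have "\<exists>p\<in>S. pderiv p \<noteq> 0 \<or> Suc (k p) \<ge> 2"
  proof (rule ccontr)
    assume "\<not> ?thesis"
    then have "\<forall>p\<in>S. inseparable_poly p" "\<forall>p\<in>S. k p = 0"
      using S(3) by (auto simp: inseparable_poly_iff_pderiv_eq_0)
    moreover from this(2) have "f = \<Prod>S"
      unfolding S(2) by (intro prod.cong) simp_all
    ultimately show False
      using f(3) S(1,3) unfolding distinct_inseparable_product_def by blast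
  qed
  then show ?thesis
    using ex_symmetric_mat_if_square_multiplier[OF char f(1,2) rs(1)] rs(2) by blast
qed

lemma not_distinct_inseparable_product_if_perfect_field:
  fixes f :: "'a :: field poly"
  assumes "perfect_field TYPE('a)" "degree f \<ge> 1"
  shows "\<not> distinct_inseparable_product f"
proof
  assume "distinct_inseparable_product f"
  then obtain P where P: "\<forall>p\<in>P. irreducible p \<and> inseparable_poly p" "f = \<Prod>P"
    unfolding distinct_inseparable_product_def by blast
  then have "P = {}"
    using separable_poly_if_perfect_field[OF assms(1)] by (auto simp: inseparable_poly_def)
  then show False
    using P(2) assms(2) by simp
qed

theorem corollary1p2:
  fixes f :: "'a :: field poly" and n :: nat
  assumes "CHAR('a) = 2"
    and "lead_coeff f = 1" and "degree f = n" and "n \<ge> 1"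
  shows "((\<exists>A \<in> carrier_mat n n. symmetric_mat A \<and> char_poly A = f) \<longleftrightarrow>
          \<not> (\<exists>P. finite P \<and>
                 (\<forall>p \<in> P. lead_coeff p = 1 \<and> irreducible p \<and> inseparable_poly p) \<and>
                 f = \<Prod>P)) \<and>
         (perfect_field TYPE('a) \<longrightarrow>
           (\<exists>A \<in> carrier_mat n n. symmetric_mat A \<and> char_poly A = f))"
proof (fold distinct_inseparable_product_def, intro conjI impI)
  show char_poly_iff: "(\<exists>A\<in>carrier_mat n n. symmetric_mat A \<and> char_poly A = f) \<longleftrightarrow>
      \<not> distinct_inseparable_product f"
    using symmetric_char_poly_not_distinct_inseparable_product[OF assms(1) _ assms(4)]
      ex_symmetric_mat_if_not_distinct_inseparable_product[OF assms(1,2)] assms(3,4) by blast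
  assume "perfect_field TYPE('a)"
  then show "\<exists>A\<in>carrier_mat n n. symmetric_mat A \<and> char_poly A = f"
    using not_distinct_inseparable_product_if_perfect_field[of f] assms(3,4)
    by (simp add: char_poly_iff)
qed

end
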